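(* Let $n,k,m$ be positive integers with $1 \leq m \leq n-2$ and $1 \leq k \leq n-1$, and let $f$ be the map on $\mathcal{P}^{U}_{n,m+1,k}$ defined in the context. Then: 1. $f$ is an injection from $\mathcal{P}^U_{n, m+1, k}$ to $\mathcal{P}^U_{n, m, k}$; 2. $f$ is (by restriction) a bijection between $\mathcal{P}^{UU}_{n,m+1,k}$ and $\mathcal{P}^{UU}_{n,m,k}$; 3. $f$ is (by restriction) a bijection between $\mathcal{P}^{UD}_{n,m+1,k}$ and $\tilde{\mathcal{P}}^{UD}_{n,m,k}$.
   Context: Let $\mathcal{L}_n$ be the set of lattice paths in $\mathbb{Z}\times\mathbb{Z}$ from $(0,0)$ to $(n,n)$ using up steps $U=(0,1)$ and down steps $D=(1,0)$. A path is identified with a word of length $2n$ in the letters $U, D$ (with $n$ of each), and juxtaposition denotes concatenation of words. An up step lies below the line $y=x$ if it goes from $(a,b)$ to $(a,b+1)$ with $b<a$. An $(n,m)$-Dyck path is a path in $\mathcal{L}_n$ with exactly $m$ up steps below the line $y=x$. A Dyck path is a (possibly empty) path from $(0,0)$ to $(r,r)$, for some $r\ge 0$, that never passes below the line $y=x$; a nonempty Dyck path is prime if it touches $y=x$ only at its starting and ending points. For a word $L$, $\phi(L)$ is the word obtained by exchanging $U$ and $D$ in every position. A peak of a path is an occurrence of two consecutive steps $UD$. $\mathcal{P}_{n,m,k}$ denotes the set of all $(n,m)$-Dyck paths with exactly $k$ peaks. For $A,B\in\{U,D\}$, $\mathcal{P}^{AB}_{n,m,k}$ denotes the set of paths in $\mathcal{P}_{n,m,k}$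 whose first step is $A$ and whose last step is $B$, and $\mathcal{P}^{U}_{n,m,k}=\mathcal{P}^{UU}_{n,m,k}\cup\mathcal{P}^{UD}_{n,m,k}$. Definition of $\tilde{\mathcal{P}}^{UD}_{n,m,k}$: let $\hat{\mathcal{P}}^{UD}_{n,m,k}$ be the set of paths in $\mathcal{P}^{U}_{n,m,k}$ of the form $UDNM$, where $\phi(N)$ and $M$ are both Dyck paths (for $1\le m\le n-2$ this is a subset of $\mathcal{P}^{UD}_{n,m,k}$); set $\tilde{\mathcal{P}}^{UD}_{n,m,k}=\mathcal{P}^{UD}_{n,m,k}\setminus\hat{\mathcal{P}}^{UD}_{n,m,k}$. Definition of $f$ (for $1\le m\le n-2$): given $P\in\mathcal{P}^U_{n,m+1,k}$, decompose $P$ uniquely as $P=SDNUQ$, where the displayed $D$ is the first down step below the line $y=x$ (i.e. the first down step ending strictly below the line) and the displayed $U$ is the first up step that ends at the line $y=x$; then $S$ and $\phi(N)$ are both Dyck paths. Case 1: if $N$ is empty and $Q$ starts with a down step, $f(P)=UDSQ$. Case 2: if $N$ is empty and $Q$ starts with an up step, $f(P)=USDQ$. Case 3: if $N$ is not empty and $\phi(N)$ is a prime Dyck path, $f(P)=USDNQ$. Case 4: if $N$ is not empty and $\phi(N)$ is not a prime Dyck path, write $N=\bar{N}R$ where $\phi(R)$ is the rightmost prime Dyck path in $\phi(N)$ (i.e. the last factor in its factorization into prime Dyck paths), and set $f(P)=UD\bar{N}SRQ$. *)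

theory Defs
  imports Main
begin

datatype step = U | D

type_synonym path = "step list"

text \<open>The point reached from the origin after the first \<open>i\<close> steps is
  \<open>(xpos w i, ypos w i)\<close>; the step with (0-based) index \<open>i\<close> leads from the point
  after \<open>i\<close> steps to the point after \<open>Suc i\<close> steps.\<close>

definition xpos :: "path \<Rightarrow> nat \<Rightarrow> nat" where
  "xpos w i = count_list (take i w) D"

definition ypos :: "path \<Rightarrow> nat \<Rightarrow> nat" where
  "ypos w i = count_list (take i w) U"

definition lattice_paths :: "nat \<Rightarrow> path set" where
  "lattice_paths n = {w. xpos w (length w) = n \<and> ypos w (length w) = n}"

definition ups_below :: "path \<Rightarrow> nat" where
  "ups_below w = card {i. i < length w \<and> w ! i = U \<and> ypos w i < xpos w i}"

definition peaks :: "path \<Rightarrow> nat" where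
  "peaks w = card {i. Suc i < length w \<and> w ! i = U \<and> w ! Suc i = D}"

definition dyck :: "path \<Rightarrow> bool" where
  "dyck w \<longleftrightarrow> (\<exists>r. w \<in> lattice_paths r) \<and> (\<forall>i\<le>length w. xpos w i \<le> ypos w i)"

definition prime_dyck :: "path \<Rightarrow> bool" where
  "prime_dyck w \<longleftrightarrow> dyck w \<and> w \<noteq> [] \<and>
     (\<forall>i. 0 < i \<and> i < length w \<longrightarrow> xpos w i \<noteq> ypos w i)"

definition prime_dyck_factors :: "path \<Rightarrow> path list" where
  "prime_dyck_factors w = (THE ws. (\<forall>v\<in>set ws. prime_dyck v) \<and> concat ws = w)"

fun flip :: "step \<Rightarrow> step" where
  "flip U = D"
| "flip D = U"

definition phi :: "path \<Rightarrow> path" where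
  "phi w = map flip w"

definition nm_dyck_paths :: "nat \<Rightarrow> nat \<Rightarrow> path set" where
  "nm_dyck_paths n m = {w \<in> lattice_paths n. ups_below w = m}"

definition P :: "nat \<Rightarrow> nat \<Rightarrow> nat \<Rightarrow> path set" where
  "P n m k = {w \<in> nm_dyck_paths n m. peaks w = k}"

definition P_ends :: "step \<Rightarrow> step \<Rightarrow> nat \<Rightarrow> nat \<Rightarrow> nat \<Rightarrow> path set" where
  "P_ends A B n m k = {w \<in> P n m k. w \<noteq> [] \<and> hd w = A \<and> last w = B}"

definition P_U :: "nat \<Rightarrow> nat \<Rightarrow> nat \<Rightarrow> path set" where
  "P_U n m k = P_ends U U n m k \<union> P_ends U D n m k"

definition P_UD_hat :: "nat \<Rightarrow> nat \<Rightarrow> nat \<Rightarrow> path set" where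
  "P_UD_hat n m k =
     {w \<in> P_U n m k. \<exists>N M. w = [U, D] @ N @ M \<and> dyck (phi N) \<and> dyck M}"

definition P_UD_tilde :: "nat \<Rightarrow> nat \<Rightarrow> nat \<Rightarrow> path set" where
  "P_UD_tilde n m k = P_ends U D n m k - P_UD_hat n m k"

definition first_down_below :: "path \<Rightarrow> nat" where
  "first_down_below w =
     (LEAST i. i < length w \<and> w ! i = D \<and> ypos w (Suc i) < xpos w (Suc i))"

definition first_up_to_line :: "path \<Rightarrow> nat" where
  "first_up_to_line w =
     (LEAST j. j < length w \<and> w ! j = U \<and> ypos w (Suc j) = xpos w (Suc j))"

text \<open>The two indices cut a path with at least one up step below the line \<open>y = x\<close>
  as \<open>S @ [D] @ N @ [U] @ Q\<close>. The map is total, but it is only meaningful on paths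
  with at least two up steps below the line that start with \<open>U\<close>; on these,
  \<open>Q\<close> is nonempty whenever \<open>N\<close> is empty, so the second branch
  is the case that \<open>Q\<close> starts with \<open>U\<close>.\<close>

definition f :: "path \<Rightarrow> path" where
  "f w =
    (let i = first_down_below w;
         j = first_up_to_line w;
         S = take i w;
         N = drop (Suc i) (take j w);
         Q = drop (Suc j) w
     in if N = [] \<and> Q \<noteq> [] \<and> hd Q = D then [U, D] @ S @ Q
        else if N = [] then [U] @ S @ [D] @ Q
        else if prime_dyck (phi N) then [U] @ S @ [D] @ N @ Q
        else let factors = prime_dyck_factors (phi N);
                 Nbar = phi (concat (butlast factors));
                 R = phi (last factors)
             in [U, D] @ Nbar @ S @ R @ Q)"

end

theory Submission
  imports Defs
begin

text \<open>A path \<open>P\<close> that starts with \<open>U\<close> and has at least two up steps below the line is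
  \<open>S D N U Q\<close>, where \<open>S\<close> is the nonempty Dyck path before the first descent below the line
  and \<open>N\<close>, seen upside down, is the Dyck path before the return to the line. The map raises the
  path: the pair \<open>D\<close>, \<open>U\<close> around \<open>N\<close> is broken up, its \<open>U\<close> is moved to the front,
  above the line, and \<open>N\<close> is shifted up by one unit, so that its up steps stay below the
  line. The up step that closed the excursion is the only one that leaves the region below.
  The valleys of \<open>P\<close> decide where the freed steps go, so that each peak that is
  destroyed is replaced by exactly one new peak.

  The relation \<open>lowers P W\<close> lists the four resulting shapes without referring to indices or
  to prime factorizations:

  \<^item> \<open>S D U D Q\<close> becomes \<open>U D S D Q\<close>;
  \<^item> \<open>S D U U Q\<close> becomes \<open>U S D U Q\<close>;
  \<^item> \<open>S D (D N U) U Q\<close> becomes \<open>U S D (D N U) Q\<close>;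
  \<^item> \<open>S D N' (D N U) U Q\<close> becomes \<open>U D N' S (D N U) Q\<close> with \<open>N'\<close> nonempty.

  On these paths the relation is the graph of the map (\<open>lowers_imp_f_eq\<close>, \<open>lowers_total\<close>), and each
  shape visibly preserves length, peaks, first and last step while removing one up step below the
  line (\<open>lowers_invariants\<close>).

  Everything else is reading a path from left to right. A word has at most one decomposition
  \<open>S D x\<close> with \<open>S\<close> a Dyck path, because the displayed \<open>D\<close> is the first step that
  reaches level \<open>-1\<close>; the same holds upside down. The four target shapes are told apart by their
  first few letters and by such decompositions, which gives injectivity (\<open>lowers_left_unique\<close>).
  Conversely, let \<open>W\<close> start with \<open>U\<close> and go below the line. Its initial part above the
  line has a first prime factor \<open>U S D\<close>. If \<open>S\<close> is nonempty, or if another prime factor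
  follows, \<open>W\<close> has one of the first three target shapes. Otherwise \<open>W\<close> is \<open>U D\<close>
  followed by a maximal nonempty part \<open>N'\<close> below the line, and either the remainder goes below
  the line again, which is the fourth shape, or it is a Dyck path, and then \<open>W\<close> is one of the
  excluded paths \<open>U D N' M\<close> (\<open>lowers_onto\<close>, \<open>lowers_not_hat\<close>). The excluded paths end
  with \<open>D\<close>, since for \<open>m \<le> n - 2\<close> their final Dyck part cannot be empty
  (\<open>hat_ends_down\<close>), so nothing is lost among the paths that end with \<open>U\<close>.\<close>

section \<open>Height above the diagonal\<close>

definition height :: "path \<Rightarrow> int" where
  "height w = int (count_list w U) - int (count_list w D)"

lemma height_simps [simp]:
  "height [] = 0"
  "height (U # w) = 1 + height w"
  "height (D # w) = height w - 1"
  "height (u @ v) = height u + height v"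
  by (auto simp: height_def)

lemma step_neq_iff [simp]: "s \<noteq> U \<longleftrightarrow> s = D" "s \<noteq> D \<longleftrightarrow> s = U"
  by (cases s; simp)+

lemma flip_flip [simp]: "flip (flip s) = s"
  by (cases s) auto

lemma phi_simps [simp]:
  "phi [] = []" "phi (s # w) = flip s # phi w" "phi (u @ v) = phi u @ phi v"
  "phi (phi w) = w" "length (phi w) = length w" "phi w = [] \<longleftrightarrow> w = []"
  by (simp_all add: phi_def comp_def)

lemma take_phi: "take i (phi w) = phi (take i w)"
  by (simp add: phi_def take_map)

lemma height_phi [simp]: "height (phi w) = - height w"
proof (induction w)
  case (Cons s w)
  then show ?case by (cases s) auto
qed simp

lemma xpos_le_ypos_iff: "xpos w i \<le> ypos w i \<longleftrightarrow> 0 \<le> height (take i w)"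
  and ypos_less_xpos_iff: "ypos w i < xpos w i \<longleftrightarrow> height (take i w) < 0"
  and xpos_eq_ypos_iff: "xpos w i = ypos w i \<longleftrightarrow> height (take i w) = 0"
  and ypos_eq_xpos_iff: "ypos w i = xpos w i \<longleftrightarrow> height (take i w) = 0"
  by (auto simp: xpos_def ypos_def height_def)

lemma lattice_paths_iff:
  "w \<in> lattice_paths n \<longleftrightarrow> count_list w U = n \<and> count_list w D = n"
  by (auto simp: lattice_paths_def xpos_def ypos_def)

lemma dyck_iff: "dyck w \<longleftrightarrow> height w = 0 \<and> (\<forall>i. 0 \<le> height (take i w))"
proof -
  have "(\<forall>i. 0 \<le> height (take i w)) \<longleftrightarrow> (\<forall>i\<le>length w. 0 \<le> height (take i w))"
    by (metis nat_le_linear order_refl take_all)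
  then show ?thesis
    by (auto simp: dyck_def lattice_paths_iff xpos_le_ypos_iff height_def)
qed

lemma dyck_height: "dyck w \<Longrightarrow> height w = 0"
  and dyck_take: "dyck w \<Longrightarrow> 0 \<le> height (take i w)"
  by (auto simp: dyck_iff)

lemma dyck_phi_height: "dyck (phi w) \<Longrightarrow> height w = 0"
  and dyck_phi_take: "dyck (phi w) \<Longrightarrow> height (take i w) \<le> 0"
  by (auto simp: dyck_iff take_phi)

lemma dyck_prefix: "dyck (u @ v) \<Longrightarrow> 0 \<le> height u"
  using dyck_take[of "u @ v" "length u"] by simp

lemma dyck_Nil [simp]: "dyck []"
  by (simp add: dyck_iff)

lemma dyck_append: "dyck u \<Longrightarrow> dyck v \<Longrightarrow> dyck (u @ v)"
  by (auto simp: dyck_iff)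

lemma dyck_append_cancel: "dyck (u @ v) \<Longrightarrow> dyck u \<Longrightarrow> dyck v"
proof -
  assume *: "dyck (u @ v)" "dyck u"
  have "0 \<le> height (take i v)" for i
    using dyck_take[OF *(1), of "length u + i"] dyck_height[OF *(2)] by simp
  then show "dyck v"
    using * by (auto simp: dyck_iff)
qed

lemma dyck_hd: "dyck w \<Longrightarrow> w \<noteq> [] \<Longrightarrow> \<exists>v. w = U # v"
  using dyck_prefix[of "[D]"] by (cases w; cases "hd w") auto

lemma dyck_last: "dyck w \<Longrightarrow> w \<noteq> [] \<Longrightarrow> \<exists>v. w = v @ [D]"
  using dyck_prefix[of "butlast w" "[U]"] dyck_height[of w]
  by (cases w rule: rev_cases; cases "last w") auto

lemma dyck_phi_hd: "dyck (phi w) \<Longrightarrow> w \<noteq> [] \<Longrightarrow> \<exists>v. w = D # v"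
  by (metis dyck_hd flip.simps(1) phi_simps(2,4,6))

lemma dyck_phi_last: "dyck (phi w) \<Longrightarrow> w \<noteq> [] \<Longrightarrow> \<exists>v. w = v @ [U]"
  by (metis dyck_last flip.simps(2) phi_simps(1,2,3,4,6))

lemma dyck_elevate: "dyck S \<Longrightarrow> dyck (U # S @ [D])"
  by (auto simp: dyck_iff take_Cons' )

section \<open>Cutting a path at its crossings of the diagonal\<close>

text \<open>The least prefix of negative height ends with a \<open>D\<close> that leaves the line; what comes
  before that step has height \<open>0\<close> and has never been below.\<close>
lemma first_descent:
  assumes "height (take i w) < 0"
  obtains S x where "w = S @ D # x" "dyck S"
proof -
  define l where "l = (LEAST i. height (take i w) < 0)"
  have neg: "height (take l w) < 0"
    unfolding l_def using assms by (rule LeastI)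
  have nonneg: "0 \<le> height (take j w)" if "j < l" for j
    using not_less_Least[of j "\<lambda>i. height (take i w) < 0"] that unfolding l_def by simp
  from neg obtain j where j: "l = Suc j"
    by (cases l) auto
  have before: "0 \<le> height (take j w)"
    using nonneg j by simp
  have "j < length w"
  proof (rule ccontr)
    assume "\<not> j < length w"
    then show False
      using neg before j by simp
  qed
  then have step: "take l w = take j w @ [w ! j]"
    using j by (simp add: take_Suc_conv_app_nth)
  have down: "w ! j = D"
    using neg before step by (cases "w ! j") auto
  have "height (take j w) = 0"
    using neg before step down by simp
  then have "dyck (take j w)"
    using nonneg j by (simp add: dyck_iff min_def)
  moreover have "w = take j w @ D # drop (Suc j) w"
    using id_take_nth_drop[OF \<open>j < length w\<close>] down by simp
  ultimately show thesis
    using that by blast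
qed

lemma first_ascent:
  assumes "height (take i w) > 0"
  obtains N x where "w = N @ U # x" "dyck (phi N)"
proof -
  have "height (take i (phi w)) < 0"
    using assms by (simp add: take_phi)
  then obtain S x where "phi w = S @ D # x" "dyck S"
    by (rule first_descent)
  then show thesis
    using that[of "phi S" "phi x"] by (metis flip.simps(2) phi_simps(2,3,4))
qed

text \<open>The displayed \<open>D\<close> is the first step to reach level \<open>-1\<close>. If one of the two Dyck paths
  were longer, it would contain that step and go below the line.\<close>
lemma first_descent_unique:
  assumes "S @ D # x = T @ D # y" "dyck S" "dyck T"
  shows "S = T \<and> x = y"
proof -
  have no_longer: "zs = []" if "dyck (A @ zs)" "dyck A" "zs @ D # b = D # a" for A zs a b
    using that dyck_prefix[of "A @ [D]"] dyck_height[of A] by (cases zs) auto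
  from assms(1) consider us where "S = T @ us" "us @ D # x = D # y"
    | us where "T = S @ us" "us @ D # y = D # x"
    unfolding append_eq_append_conv2 by metis
  then show ?thesis
    by cases (use no_longer assms(2,3) in \<open>fastforce+\<close>)
qed

lemma first_ascent_unique:
  assumes "S @ U # x = T @ U # y" "dyck (phi S)" "dyck (phi T)"
  shows "S = T \<and> x = y"
proof -
  have "phi S @ D # phi x = phi T @ D # phi y"
    using arg_cong[OF assms(1), of phi] by simp
  then show ?thesis
    using first_descent_unique assms(2,3) by (metis phi_simps(4))
qed

text \<open>Behind its initial \<open>U\<close> a Dyck path must descend to level \<open>-1\<close> relative to that step,
  and its first descent there is the first return to the line.\<close>
lemma dyck_first_return:
  assumes "dyck w" "w \<noteq> []"
  obtains S v where "w = U # S @ D # v" "dyck S" "dyck v"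
proof -
  obtain y where y: "w = U # y"
    using assms dyck_hd by blast
  then have "height (take (length y) y) < 0"
    using assms(1) dyck_height by fastforce
  then obtain S v where S: "y = S @ D # v" "dyck S"
    by (rule first_descent)
  then have "dyck v"
    using dyck_append_cancel[of "U # S @ [D]" v] dyck_elevate[of S] assms(1) y by simp
  with S y show thesis
    using that by blast
qed

section \<open>Prime factorization\<close>

lemma prime_dyck_iff: "prime_dyck w \<longleftrightarrow> (\<exists>S. dyck S \<and> w = U # S @ [D])"
proof
  assume w: "prime_dyck w"
  then obtain S v where S: "w = U # S @ D # v" "dyck S" "dyck v"
    unfolding prime_dyck_def using dyck_first_return by metis
  have "height (take (length S + 2) w) = 0"
    using S dyck_height[of S] by simp
  then have "v = []"
    using w S(1) unfolding prime_dyck_def xpos_eq_ypos_iff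
    by (cases v) (auto dest!: spec[of _ "length S + 2"])
  with S show "\<exists>S. dyck S \<and> w = U # S @ [D]"
    by auto
next
  assume "\<exists>S. dyck S \<and> w = U # S @ [D]"
  then obtain S where S: "dyck S" "w = U # S @ [D]"
    by blast
  have "height (take i w) \<noteq> 0" if "0 < i" "i < length w" for i
    using that S dyck_take[OF S(1), of "i - 1"] by (auto simp: take_Cons')
  with S dyck_elevate show "prime_dyck w"
    by (auto simp: prime_dyck_def xpos_eq_ypos_iff)
qed

lemma ex_prime_factors:
  "dyck w \<Longrightarrow> \<exists>ws. (\<forall>v\<in>set ws. prime_dyck v) \<and> concat ws = w"
proof (induction "length w" arbitrary: w rule: less_induct)
  case less
  show ?case
  proof (cases "w = []")
    case True
    then show ?thesis
      by (intro exI[of _ "[]"]) simp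
  next
    case False
    then obtain S v where S: "w = U # S @ D # v" "dyck S" "dyck v"
      using less.prems dyck_first_return by metis
    then obtain ws where "\<forall>v\<in>set ws. prime_dyck v" "concat ws = v"
      using less.hyps[of v] by auto
    with S show ?thesis
      by (intro exI[of _ "(U # S @ [D]) # ws"]) (auto simp: prime_dyck_iff)
  qed
qed

text \<open>A prime path is \<open>U S D\<close> with \<open>S\<close> a Dyck path, so the uniqueness of the first descent
  determines the first factor. This is what makes the definite description in
  \<open>prime_dyck_factors\<close> meaningful.\<close>
lemma prime_factors_unique:
  assumes "concat us = concat vs" "\<forall>v\<in>set us. prime_dyck v" "\<forall>v\<in>set vs. prime_dyck v"
  shows "us = vs"
  using assms
proof (induction us arbitrary: vs)
  case Nil
  then show ?case
    by (cases vs) (auto simp: prime_dyck_iff)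
next
  case (Cons u us)
  then obtain v vs' where vs: "vs = v # vs'"
    by (cases vs) (auto simp: prime_dyck_iff)
  obtain S T where "u = U # S @ [D]" "v = U # T @ [D]" "dyck S" "dyck T"
    using Cons.prems vs by (auto simp: prime_dyck_iff)
  then have "u = v" "concat us = concat vs'"
    using first_descent_unique[of S "concat us" T "concat vs'"] Cons.prems(1) vs by auto
  with Cons vs show ?case
    by auto
qed

lemma prime_dyck_factors_eq:
  "\<forall>v\<in>set ws. prime_dyck v \<Longrightarrow> prime_dyck_factors (concat ws) = ws"
  unfolding prime_dyck_factors_def by (rule the_equality) (auto intro: prime_factors_unique)

section \<open>Counting up steps below the diagonal\<close>

text \<open>A starting height is carried along, since factors of a path do not start on the line; this
  makes the count additive under concatenation.\<close>
definition ups_under :: "int \<Rightarrow> path \<Rightarrow> nat" where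
  "ups_under h w = card {i. i < length w \<and> w ! i = U \<and> h + height (take i w) < 0}"

lemma ups_below_eq: "ups_below w = ups_under 0 w"
  by (simp add: ups_below_def ups_under_def ypos_less_xpos_iff)

lemma ups_under_append: "ups_under h (u @ v) = ups_under h u + ups_under (h + height u) v"
proof -
  let ?A = "{i. i < length u \<and> u ! i = U \<and> h + height (take i u) < 0}"
  let ?B = "{i. i < length v \<and> v ! i = U \<and> h + height u + height (take i v) < 0}"
  have "{i. i < length (u @ v) \<and> (u @ v) ! i = U \<and> h + height (take i (u @ v)) < 0}
    = ?A \<union> (\<lambda>i. length u + i) ` ?B" (is "?L = ?R")
  proof (rule set_eqI)
    fix i
    show "i \<in> ?L \<longleftrightarrow> i \<in> ?R"
    proof (cases "i < length u")
      case False
      then obtain j where "i = length u + j"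
        using le_Suc_ex not_less by blast
      then show ?thesis
        by (auto simp: nth_append add.assoc)
    qed (auto simp: nth_append)
  qed
  moreover have "card (?A \<union> (\<lambda>i. length u + i) ` ?B) = card ?A + card ((\<lambda>i. length u + i) ` ?B)"
    by (rule card_Un_disjoint) auto
  ultimately show ?thesis
    by (simp add: ups_under_def card_image)
qed

lemma ups_under_Nil [simp]: "ups_under h [] = 0"
  by (simp add: ups_under_def)

lemma ups_under_Cons [simp]:
  "ups_under h (U # w) = (if h < 0 then 1 else 0) + ups_under (h + 1) w"
  "ups_under h (D # w) = ups_under (h - 1) w"
proof -
  have "{i. i < Suc 0 \<and> [U] ! i = U \<and> h + height (take i [U]) < 0} = (if h < 0 then {0} else {})"
    by auto
  then show "ups_under h (U # w) = (if h < 0 then 1 else 0) + ups_under (h + 1) w"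
    using ups_under_append[of h "[U]" w] by (simp add: ups_under_def)
  have "{i. i < Suc 0 \<and> [D] ! i = U \<and> h + height (take i [D]) < 0} = {}"
    by auto
  then show "ups_under h (D # w) = ups_under (h - 1) w"
    using ups_under_append[of h "[D]" w] by (simp add: ups_under_def)
qed

lemma ups_under_eq_0: "(\<And>i. 0 \<le> height (take i w)) \<Longrightarrow> 0 \<le> h \<Longrightarrow> ups_under h w = 0"
proof -
  assume "\<And>i. 0 \<le> height (take i w)" "0 \<le> h"
  then have "\<not> h + height (take i w) < 0" for i
    by (simp add: not_less)
  then show "ups_under h w = 0"
    by (simp add: ups_under_def)
qed

lemma ups_under_dyck: "dyck w \<Longrightarrow> 0 \<le> h \<Longrightarrow> ups_under h w = 0"
  by (auto intro: ups_under_eq_0 dyck_take)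

text \<open>Each up step of such a path starts strictly below the level that the path never exceeds, so
  lowering the whole path does not change the count. This lets \<open>N\<close> be shifted up to the line.\<close>
lemma ups_under_dyck_phi:
  assumes "dyck (phi w)" "h \<le> 0"
  shows "ups_under h w = count_list w U"
proof -
  have "h + height (take i w) < 0" if "i < length w" "w ! i = U" for i
    using dyck_phi_take[OF assms(1), of "Suc i"] that assms(2)
    by (simp add: take_Suc_conv_app_nth)
  then have "{i. i < length w \<and> w ! i = U \<and> h + height (take i w) < 0}
    = {i. i < length w \<and> U = w ! i}"
    by auto
  then show ?thesis
    by (simp add: ups_under_def count_list_eq_length_filter length_filter_conv_card)
qed

lemma ups_below_split:
  assumes "height w = 0" "ups_below w > 0"
  obtains S N Q where "w = S @ D # N @ U # Q" "dyck S" "dyck (phi N)"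
proof -
  obtain i where "height (take i w) < 0"
    using ups_under_eq_0[of w 0] assms(2) by (metis less_irrefl not_less order_refl ups_below_eq)
  then obtain S x where S: "w = S @ D # x" "dyck S"
    by (rule first_descent)
  then have "height (take (length x) x) > 0"
    using assms(1) dyck_height[of S] by simp
  then obtain N Q where "x = N @ U # Q" "dyck (phi N)"
    by (rule first_ascent)
  with S show thesis
    using that by blast
qed

section \<open>Peaks of concatenations\<close>

lemma peaks_Cons:
  "peaks (s # w) = (if s = U \<and> w \<noteq> [] \<and> hd w = D then 1 else 0) + peaks w"
proof -
  let ?A = "{i. Suc i < length w \<and> w ! i = U \<and> w ! Suc i = D}"
  let ?c = "s = U \<and> w \<noteq> [] \<and> hd w = D"
  have "{i. Suc i < length (s # w) \<and> (s # w) ! i = U \<and> (s # w) ! Suc i = D}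
    = (if ?c then {0} else {}) \<union> Suc ` ?A" (is "?L = ?R")
  proof (rule set_eqI)
    fix i
    show "i \<in> ?L \<longleftrightarrow> i \<in> ?R"
      by (cases i) (auto simp: hd_conv_nth)
  qed
  moreover have "finite ?A"
    by (rule finite_subset[of _ "{..<length w}"]) auto
  ultimately show ?thesis
    by (auto simp: peaks_def card_image card_insert_if)
qed

lemma peaks_Nil [simp]: "peaks [] = 0"
  by (simp add: peaks_def)

lemma peaks_append:
  "peaks (u @ v) = peaks u + peaks v +
     (if u \<noteq> [] \<and> last u = U \<and> v \<noteq> [] \<and> hd v = D then 1 else 0)"
  by (induction u) (auto simp: peaks_Cons hd_append)

section \<open>The map as a relation on decomposed paths\<close>

text \<open>The rules are named after what follows the first descent of the first path: a valley on which the
  path returns to the line at once, or an excursion whose part strictly below level \<open>-1\<close>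
  is prime or composite. Writing the last prime factor as \<open>D N U\<close> keeps every piece free of
  primality conditions. In the first two rules the letter after the return is displayed: if \<open>Q\<close>
  could be empty in \<open>S D U Q\<close>, the last step of the path would change.\<close>
inductive lowers :: "path \<Rightarrow> path \<Rightarrow> bool" where
  valley_then_down:
    "dyck S \<Longrightarrow> S \<noteq> [] \<Longrightarrow>
     lowers (S @ D # U # D # Q) (U # D # S @ D # Q)"
| valley_then_up:
    "dyck S \<Longrightarrow> S \<noteq> [] \<Longrightarrow>
     lowers (S @ D # U # U # Q) (U # S @ D # U # Q)"
| prime_below:
    "dyck S \<Longrightarrow> S \<noteq> [] \<Longrightarrow> dyck (phi N) \<Longrightarrow>
     lowers (S @ D # D # N @ U # U # Q) (U # S @ D # D # N @ U # Q)"
| composite_below: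
    "dyck S \<Longrightarrow> S \<noteq> [] \<Longrightarrow> dyck (phi N') \<Longrightarrow> N' \<noteq> [] \<Longrightarrow> dyck (phi N) \<Longrightarrow>
     lowers (S @ D # N' @ D # N @ U # U # Q) (U # D # N' @ S @ D # N @ U # Q)"

text \<open>The two indices in the definition of the map find exactly the \<open>D\<close> and the \<open>U\<close> that are
  displayed: \<open>S\<close> stays above the line, and \<open>N\<close>, which starts at level \<open>-1\<close>, stays
  at or below that level.\<close>
lemma f_split:
  assumes "dyck S" "dyck (phi N)"
  shows "f (S @ D # N @ U # Q) =
    (if N = [] \<and> Q \<noteq> [] \<and> hd Q = D then U # D # S @ Q
     else if N = [] then U # S @ D # Q
     else if prime_dyck (phi N) then U # S @ D # N @ Q
     else U # D # phi (concat (butlast (prime_dyck_factors (phi N)))) @ S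
            @ phi (last (prime_dyck_factors (phi N))) @ Q)"
proof -
  let ?w = "S @ D # N @ U # Q"
  have hS: "height S = 0" and hN: "height N = 0"
    using assms dyck_height dyck_phi_height by auto
  have i: "first_down_below ?w = length S"
    unfolding first_down_below_def ypos_less_xpos_iff
  proof (rule Least_equality)
    fix j
    assume j: "j < length ?w \<and> ?w ! j = D \<and> height (take (Suc j) ?w) < 0"
    show "length S \<le> j"
    proof (rule ccontr)
      assume "\<not> length S \<le> j"
      then have "take (Suc j) ?w = take (Suc j) S"
        by simp
      then show False
        using j dyck_take[OF assms(1), of "Suc j"] by simp
    qed
  qed (use hS in \<open>auto simp: nth_append\<close>)
  have j: "first_up_to_line ?w = length S + Suc (length N)"
    unfolding first_up_to_line_def ypos_eq_xpos_iff
  proof (rule Least_equality)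
    fix j
    assume j: "j < length ?w \<and> ?w ! j = U \<and> height (take (Suc j) ?w) = 0"
    have "take (Suc j) ?w = take j ?w @ [?w ! j]"
      by (rule take_Suc_conv_app_nth) (use j in blast)
    also have "height \<dots> = height (take j ?w) + 1"
      using j by (simp only: height_simps)
    finally have below: "height (take j ?w) = -1"
      using j by linarith
    show "length S + Suc (length N) \<le> j"
    proof (rule ccontr)
      assume "\<not> length S + Suc (length N) \<le> j"
      then have less: "j < length S + Suc (length N)"
        by simp
      show False
      proof (cases "j \<le> length S")
        case True
        then show False
          using below dyck_take[OF assms(1), of j] by simp
      next
        case False
        then obtain l where l: "j = length S + Suc l"
          using less_imp_Suc_add[of "length S" j] by auto
        with less have "l < length N"
          by simp
        with l have "height (take (Suc j) ?w) = height (take (Suc l) N) - 1"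
          using hS by simp
        then show False
          using j dyck_phi_take[OF assms(2), of "Suc l"] by simp
      qed
    qed
  qed (use hS hN in \<open>auto simp: nth_append\<close>)
  have cut: "take (length S) ?w = S" "drop (Suc (length S)) (take (length S + Suc (length N)) ?w) = N"
    "drop (Suc (length S + Suc (length N))) ?w = Q"
    by auto
  show ?thesis
    unfolding f_def Let_def i j by (simp only: cut append.simps)
qed

lemma lowers_imp_f_eq: "lowers w v \<Longrightarrow> f w = v"
proof (induction rule: lowers.induct)
  case (valley_then_down S Q)
  then show ?case
    using f_split[of S "[]" "D # Q"] by simp
next
  case (valley_then_up S Q)
  then show ?case
    using f_split[of S "[]" "U # Q"] by simp
next
  case (prime_below S N Q)
  have *: "prime_dyck (phi (D # N @ [U]))"
    using prime_below by (auto simp: prime_dyck_iff)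
  with prime_below show ?case
    using f_split[of S "D # N @ [U]" "U # Q"] f_split[of S "D # N @ [U]" Q]
    by (auto simp: prime_dyck_def)
next
  case (composite_below S N' N Q)
  let ?R = "D # N @ [U]"
  obtain ws where ws: "\<forall>v\<in>set ws. prime_dyck v" "concat ws = phi N'"
    using ex_prime_factors composite_below by blast
  have R: "prime_dyck (phi ?R)"
    using composite_below by (auto simp: prime_dyck_iff)
  have factors: "prime_dyck_factors (phi (N' @ ?R)) = ws @ [phi ?R]"
    using prime_dyck_factors_eq[of "ws @ [phi ?R]"] ws R by simp
  have "\<not> prime_dyck (phi (N' @ ?R))"
  proof
    assume *: "prime_dyck (phi (N' @ ?R))"
    have "[phi (N' @ ?R)] = ws @ [phi ?R]"
      using prime_factors_unique[of "[phi (N' @ ?R)]" "ws @ [phi ?R]"] * ws R by simp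
    then show False
      using composite_below.hyps(4) by auto
  qed
  moreover have "dyck (phi (N' @ ?R))"
    using composite_below R by (auto simp: prime_dyck_def intro: dyck_append)
  ultimately show ?case
    using f_split[of S "N' @ ?R" "U # Q"] f_split[of S "N' @ ?R" Q] composite_below ws
    by (simp add: factors[simplified])
qed

text \<open>The second path is parsed from the left. If its second letter is \<open>U\<close>, the first return after
  that letter determines \<open>S\<close>, and the next letter distinguishes the second and the third rule.
  If it is \<open>D\<close>, the third letter distinguishes the first rule, where the nonempty \<open>S\<close>
  begins, from the fourth, where the nonempty \<open>N'\<close> begins. In the fourth rule the first ascent
  above the line determines \<open>N'\<close>, because \<open>S\<close> starts with \<open>U\<close>.\<close>
lemma lowers_left_unique:
  assumes "lowers w v" "lowers w' v"
  shows "w = w'"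
  using assms(1)
proof (cases rule: lowers.cases)
  case (valley_then_down S Q)
  then obtain s where s: "S = U # s"
    using dyck_hd by blast
  from assms(2) show ?thesis
  proof (cases rule: lowers.cases)
    case (valley_then_down T R)
    then show ?thesis
      using \<open>v = U # D # S @ D # Q\<close> \<open>w = _\<close> \<open>dyck S\<close> first_descent_unique[of S Q T R] by auto
  next
    case (composite_below T N' N R)
    then show ?thesis
      using \<open>v = U # D # S @ D # Q\<close> s dyck_phi_hd[of N'] by auto
  qed (use \<open>v = U # D # S @ D # Q\<close> dyck_hd in fastforce)+
next
  case (valley_then_up S Q)
  then obtain s where s: "S = U # s"
    using dyck_hd by blast
  note v = \<open>v = U # S @ D # U # Q\<close>
  from assms(2) show ?thesis
  proof (cases rule: lowers.cases)
    case (valley_then_up T R)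
    then show ?thesis
      using v \<open>w = _\<close> \<open>dyck S\<close> first_descent_unique[of S "U # Q" T "U # R"] by auto
  next
    case (prime_below T N R)
    then show ?thesis
      using v \<open>dyck S\<close> first_descent_unique[of S "U # Q" T "D # N @ U # R"] by auto
  qed (use v s in auto)
next
  case (prime_below S N Q)
  then obtain s where s: "S = U # s"
    using dyck_hd by blast
  note v = \<open>v = U # S @ D # D # N @ U # Q\<close>
  from assms(2) show ?thesis
  proof (cases rule: lowers.cases)
    case (valley_then_up T R)
    then show ?thesis
      using v \<open>dyck S\<close> first_descent_unique[of S "D # N @ U # Q" T "U # R"] by auto
  next
    case (prime_below T M R)
    then show ?thesis
      using v \<open>w = _\<close> \<open>dyck S\<close> \<open>dyck (phi N)\<close> first_ascent_unique[of N Q M R]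
        first_descent_unique[of S "D # N @ U # Q" T "D # M @ U # R"] by auto
  qed (use v s in auto)
next
  case (composite_below S N' N Q)
  then obtain s where s: "S = U # s"
    using dyck_hd by blast
  note v = \<open>v = U # D # N' @ S @ D # N @ U # Q\<close>
  from assms(2) show ?thesis
  proof (cases rule: lowers.cases)
    case (valley_then_down T R)
    then show ?thesis
      using v \<open>dyck (phi N')\<close> \<open>N' \<noteq> []\<close> dyck_phi_hd[of N'] dyck_hd[of T] by auto
  next
    case (composite_below T M' M R)
    then obtain t where t: "T = U # t"
      using dyck_hd by blast
    have "N' = M' \<and> s @ D # N @ U # Q = t @ D # M @ U # R"
      using first_ascent_unique[of N' "s @ D # N @ U # Q" M' "t @ D # M @ U # R"]
        v composite_below s t \<open>dyck (phi N')\<close> by simp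
    then have "N' = M' \<and> S = T \<and> N @ U # Q = M @ U # R"
      using first_descent_unique[of S "N @ U # Q" T "M @ U # R"] s t \<open>dyck S\<close> \<open>dyck T\<close> by auto
    then show ?thesis
      using first_ascent_unique[of N Q M R] composite_below \<open>w = _\<close> \<open>dyck (phi N)\<close> by auto
  qed (use v dyck_hd in fastforce)+
qed

text \<open>Each of the factors \<open>S\<close> and \<open>N\<close> keeps its inner peaks, so only the junctions matter;
  these are determined by the first and last letters of the factors. In the first and the fourth rule
  a peak of the first path at \<open>U D\<close> behind the valley, or between \<open>N'\<close> and its successor,
  is traded for the new initial peak.\<close>
lemma lowers_invariants:
  assumes "lowers w v"
  shows "count_list v = count_list w" "peaks v = peaks w" "ups_below w = Suc (ups_below v)"
    "w \<noteq> []" "v \<noteq> []" "hd v = hd w" "last v = last w"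
proof -
  have outer: "height S = 0 \<and> ups_under 0 S = 0 \<and> ups_under 1 S = 0 \<and> hd S = U \<and> last S = D"
    if "dyck S" "S \<noteq> []" for S
  proof -
    have "hd S = U"
      using dyck_hd[OF that] by auto
    moreover have "last S = D"
      using dyck_last[OF that] by auto
    ultimately show ?thesis
      using that by (simp add: dyck_height ups_under_dyck)
  qed
  have inner: "height N = 0 \<and> ups_under 0 N = count_list N U \<and> ups_under (-1) N = count_list N U
      \<and> ups_under (-2) N = count_list N U \<and> (N \<noteq> [] \<longrightarrow> hd N = D \<and> last N = U)"
    if "dyck (phi N)" for N
  proof -
    have "N \<noteq> [] \<longrightarrow> hd N = D"
      using dyck_phi_hd[OF that] by auto
    moreover have "N \<noteq> [] \<longrightarrow> last N = U"
      using dyck_phi_last[OF that] by auto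
    ultimately show ?thesis
      using that by (simp add: dyck_phi_height ups_under_dyck_phi)
  qed
  have "(\<forall>s. count_list v s = count_list w s) \<and> peaks v = peaks w \<and> ups_below w = Suc (ups_below v)
    \<and> w \<noteq> [] \<and> v \<noteq> [] \<and> hd v = hd w \<and> last v = last w"
    using assms
  proof cases
    case (valley_then_down S Q)
    with outer[of S] show ?thesis
      by (clarsimp simp: ups_below_eq ups_under_append peaks_append peaks_Cons)
  next
    case (valley_then_up S Q)
    with outer[of S] show ?thesis
      by (clarsimp simp: ups_below_eq ups_under_append peaks_append peaks_Cons)
  next
    case (prime_below S N Q)
    with outer[of S] inner[of N] show ?thesis
      by (clarsimp simp: ups_below_eq ups_under_append peaks_append peaks_Cons hd_append)
  next
    case (composite_below S N' N Q)
    with outer[of S] inner[of N] inner[of N'] show ?thesis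
      by (clarsimp simp: ups_below_eq ups_under_append peaks_append peaks_Cons hd_append)
  qed
  then show "count_list v = count_list w" "peaks v = peaks w" "ups_below w = Suc (ups_below v)"
    "w \<noteq> []" "v \<noteq> []" "hd v = hd w" "last v = last w"
    by (auto simp: fun_eq_iff)
qed

text \<open>The prime factorization read from the right: its last factor \<open>U S D\<close> is split off.\<close>
lemma dyck_last_prime:
  "dyck w \<Longrightarrow> w \<noteq> [] \<Longrightarrow> \<exists>v S. w = v @ U # S @ [D] \<and> dyck v \<and> dyck S"
proof (induction "length w" arbitrary: w rule: less_induct)
  case less
  then obtain S v where S: "w = U # S @ D # v" "dyck S" "dyck v"
    using dyck_first_return by metis
  show ?case
  proof (cases "v = []")
    case True
    with S show ?thesis
      by (intro exI[of _ "[]"] exI[of _ S]) auto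
  next
    case False
    then obtain v' S' where "v = v' @ U # S' @ [D]" "dyck v'" "dyck S'"
      using less.hyps[of v] S by auto
    moreover from this have "dyck (U # S @ D # v')"
      using dyck_append[OF dyck_elevate[OF S(2)], of v'] by simp
    ultimately show ?thesis
      using S(1) by (intro exI[of _ "U # S @ D # v'"] exI[of _ S']) auto
  qed
qed

text \<open>Two up steps below the line are needed: with only one, the path may end right after
  the valley \<open>S D U\<close>, where none of the rules applies.\<close>
lemma lowers_total:
  assumes "height w = 0" "ups_below w > 1" "hd w = U"
  shows "\<exists>v. lowers w v"
proof -
  obtain S N Q where w: "w = S @ D # N @ U # Q" and S: "dyck S" and N: "dyck (phi N)"
    using ups_below_split assms by (metis less_trans zero_less_one)
  have "S \<noteq> []"
    using w assms(3) by auto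
  show ?thesis
  proof (cases "N = []")
    case True
    have "Q \<noteq> []"
      using assms(2) S unfolding w True
      by (auto simp: ups_below_eq ups_under_append ups_under_dyck dyck_height)
    then obtain s Q' where "Q = s # Q'"
      by (cases Q) auto
    then show ?thesis
      using w True S \<open>S \<noteq> []\<close> by (cases s) (auto intro: lowers.intros)
  next
    case False
    then obtain M' M where "phi N = M' @ U # M @ [D]" "dyck M'" "dyck M"
      using dyck_last_prime[of "phi N"] N by auto
    then have "N = phi M' @ D # phi M @ [U]"
      by (metis flip.simps phi_simps(1-4))
    then show ?thesis
      using w S \<open>S \<noteq> []\<close> \<open>dyck M'\<close> \<open>dyck M\<close> lowers.prime_below[of S "phi M" Q]
        lowers.composite_below[of S "phi M'" "phi M" Q]
      by (cases "M' = []") auto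
  qed
qed

text \<open>In the first and the fourth rule the second path returns to the line with an \<open>S\<close> that
  follows \<open>U D\<close> and \<open>U D N'\<close> respectively, and it goes below the line once more after
  \<open>S\<close>. So what follows the maximal part \<open>N\<close> below the line is not a Dyck path. In the
  other two rules the second letter is \<open>U\<close>.\<close>
lemma lowers_not_hat:
  assumes "lowers w v" "dyck (phi N)" "dyck M"
  shows "v \<noteq> U # D # N @ M"
proof
  assume v: "v = U # D # N @ M"
  from assms(1) show False
  proof (cases rule: lowers.cases)
    case (valley_then_down S Q)
    show False
    proof (cases "N = []")
      case True
      then show False
        using v valley_then_down assms(3) dyck_prefix[of "S @ [D]" Q] dyck_height[of S] by auto
    next
      case False
      then show False
        using v valley_then_down dyck_hd[of S] dyck_phi_hd[OF assms(2)] by auto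
    qed
  next
    case (composite_below S N' N1 Q)
    then obtain s where s: "S = U # s"
      using dyck_hd by blast
    have eq: "N' @ U # s @ D # N1 @ U # Q = N @ M"
      using v composite_below s by simp
    show False
    proof (cases "M = []")
      case True
      then show False
        using dyck_phi_take[OF assms(2), of "Suc (length N')"] eq composite_below
          dyck_phi_height[of N'] by (auto simp flip: eq)
    next
      case False
      then obtain M' where M': "M = U # M'"
        using assms(3) dyck_hd by blast
      then have "M = S @ D # N1 @ U # Q"
        using first_ascent_unique[of N' "s @ D # N1 @ U # Q" N M'] eq s composite_below assms(2)
        by auto
      then show False
        using assms(3) dyck_prefix[of "S @ [D]" "N1 @ U # Q"] composite_below dyck_height[of S]
        by auto
    qed
  qed (use v dyck_hd in fastforce)+
qed

text \<open>The case distinction is on the first prime factor \<open>U S D\<close> of the part before the first descent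
  and on the rest \<open>T'\<close> of that part. If both \<open>S\<close> and \<open>T'\<close> are empty, the path is
  \<open>U D x\<close> where \<open>x\<close> starts below the line. The hypothesis forbids \<open>x\<close> to stay
  below for ever, and it forbids its remainder after the first ascent to stay above for ever; the second
  crossing supplies the pieces of the fourth rule.\<close>
lemma lowers_onto:
  assumes "height v = 0" "ups_below v > 0" "hd v = U"
    and not_hat: "\<And>N M. dyck (phi N) \<Longrightarrow> dyck M \<Longrightarrow> v \<noteq> U # D # N @ M"
  shows "\<exists>w. lowers w v"
proof -
  obtain T N Q where v: "v = T @ D # N @ U # Q" and T: "dyck T" and N: "dyck (phi N)"
    using ups_below_split assms by metis
  have "T \<noteq> []"
    using v assms(3) by auto
  then obtain S T' where S: "T = U # S @ D # T'" "dyck S" "dyck T'"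
    using T dyck_first_return by metis
  show ?thesis
  proof (cases "S = []"; cases "T' = []")
    assume "S \<noteq> []" "T' \<noteq> []"
    moreover from this obtain t where "T' = U # t"
      using S dyck_hd by blast
    ultimately show ?thesis
      using v S lowers.valley_then_up[of S "t @ D # N @ U # Q"] by auto
  next
    assume "S \<noteq> []" "T' = []"
    then show ?thesis
      using v S N lowers.prime_below[of S N Q] by auto
  next
    assume "S = []" "T' \<noteq> []"
    then show ?thesis
      using v S lowers.valley_then_down[of T' "N @ U # Q"] by auto
  next
    assume "S = []" "T' = []"
    define x where "x = D # N @ U # Q"
    have vx: "v = U # D # x"
      using v S \<open>S = []\<close> \<open>T' = []\<close> by (simp add: x_def)
    have "\<not> dyck (phi x)"
      using not_hat[of x "[]"] vx by auto
    moreover have "height (phi x) = 0"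
      using vx assms(1) by simp
    ultimately obtain i where "height (take i x) > 0"
      by (auto simp: dyck_iff take_phi not_le)
    then obtain N' y where y: "x = N' @ U # y" "dyck (phi N')"
      by (rule first_ascent)
    have "N' \<noteq> []"
      using y(1) by (auto simp: x_def)
    have "\<not> dyck (U # y)"
      using not_hat[of N' "U # y"] vx y by auto
    moreover have hy: "height (U # y) = 0"
      using vx y assms(1) dyck_phi_height[of N'] by simp
    ultimately obtain i where "height (take i (U # y)) < 0"
      unfolding dyck_iff by (meson not_le)
    then obtain R z where R: "U # y = R @ D # z" "dyck R"
      by (rule first_descent)
    then have "height (take (length z) z) > 0"
      using hy dyck_height[of R] by (metis R add.commute diff_add_cancel height_simps(3,4)
          add_0 order_refl take_all zero_less_one)
    then obtain M Z where "z = M @ U # Z" "dyck (phi M)"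
      by (rule first_ascent)
    then show ?thesis
      using vx y R \<open>N' \<noteq> []\<close> lowers.composite_below[of R N' M Z] by (cases R) auto
  qed
qed

section \<open>The bijections\<close>

lemma lowers_P_ends_iff:
  "lowers w v \<Longrightarrow> w \<in> P_ends A B n (m + 1) k \<longleftrightarrow> v \<in> P_ends A B n m k"
  by (simp add: P_ends_def P_def nm_dyck_paths_def lattice_paths_iff lowers_invariants)

lemma P_ends_height: "w \<in> P_ends A B n m k \<Longrightarrow> height w = 0"
  by (auto simp: P_ends_def P_def nm_dyck_paths_def lattice_paths_iff height_def)

text \<open>If \<open>M\<close> were empty, all up steps of \<open>U D N\<close> except the first would be below the line,
  and \<open>m\<close> would be \<open>n - 1\<close>.\<close>
lemma hat_ends_down:
  assumes "v \<in> P_UD_hat n m k" "m \<le> n - 2" "1 \<le> m"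
  shows "last v = D"
proof -
  obtain N M where v: "v = U # D # N @ M" "dyck (phi N)" "dyck M" "v \<in> P_U n m k"
    using assms(1) by (auto simp: P_UD_hat_def)
  have "M \<noteq> []"
  proof
    assume "M = []"
    then have "ups_below v = count_list N U" "count_list v U = Suc (count_list N U)"
      using v by (auto simp: ups_below_eq ups_under_dyck_phi)
    moreover have "ups_below v = m" "count_list v U = n"
      using v(4) by (auto simp: P_U_def P_ends_def P_def nm_dyck_paths_def lattice_paths_iff)
    ultimately show False
      using assms by simp
  qed
  then show ?thesis
    using v dyck_last[of M] by auto
qed

theorem theorem4:
  fixes n m k :: nat
  assumes "1 \<le> m" and "m \<le> n - 2" and "1 \<le> k" and "k \<le> n - 1"
  shows "f ` P_U n (m + 1) k \<subseteq> P_U n m k \<and> inj_on f (P_U n (m + 1) k)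
    \<and> bij_betw f (P_ends U U n (m + 1) k) (P_ends U U n m k)
    \<and> bij_betw f (P_ends U D n (m + 1) k) (P_UD_tilde n m k)"
proof -
  have f_lowers: "lowers w (f w)" if "w \<in> P_ends U B n (m + 1) k" for w B
  proof -
    have "\<exists>v. lowers w v"
      using that assms(1) P_ends_height
      by (intro lowers_total) (auto simp: P_ends_def P_def nm_dyck_paths_def)
    then show ?thesis
      using lowers_imp_f_eq by auto
  qed
  have f_mem: "f w \<in> P_ends U B n m k - P_UD_hat n m k" if "w \<in> P_ends U B n (m + 1) k" for w B
    using f_lowers[OF that] that lowers_P_ends_iff lowers_not_hat
    by (fastforce simp: P_UD_hat_def)
  have inj: "inj_on f (P_U n (m + 1) k)"
    by (rule inj_onI) (metis P_U_def Un_iff f_lowers lowers_left_unique)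
  have onto: "v \<in> f ` P_ends U B n (m + 1) k" if v: "v \<in> P_ends U B n m k - P_UD_hat n m k" for v B
  proof -
    have "v \<in> P_U n m k"
      using v by (cases B) (auto simp: P_U_def)
    then have "v \<noteq> U # D # N @ M" if "dyck (phi N)" "dyck M" for N M
      using v that by (auto simp: P_UD_hat_def)
    moreover have "height v = 0" "ups_below v > 0" "hd v = U"
      using v assms(1) P_ends_height by (auto simp: P_ends_def P_def nm_dyck_paths_def)
    ultimately obtain w where "lowers w v"
      using lowers_onto by metis
    then show ?thesis
      using v lowers_P_ends_iff lowers_imp_f_eq by blast
  qed
  have bij: "bij_betw f (P_ends U B n (m + 1) k) (P_ends U B n m k - P_UD_hat n m k)" for B
  proof -
    have "P_ends U B n (m + 1) k \<subseteq> P_U n (m + 1) k"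
      by (cases B) (auto simp: P_U_def)
    then show ?thesis
      using inj_on_subset[OF inj] f_mem onto by (auto simp: bij_betw_def)
  qed
  have "P_ends U U n m k - P_UD_hat n m k = P_ends U U n m k"
    using hat_ends_down assms(1,2) by (fastforce simp: P_ends_def)
  with bij[of U] bij[of D] inj f_mem show ?thesis
    by (auto simp: P_UD_tilde_def P_U_def)
qed

end
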